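(* Let $n,m\ge 1$, let $h(k,\cdot):\mathbb R^n\to\mathbb R^m$ be the measurement function, let $R_k\in\mathbb R^{m\times m}$ be a symmetric positive definite measurement noise covariance with SVD factors $Q_{R_k}$ (orthogonal) and $D_{R_k}^{1/2}$ (diagonal), let $\hat x_{k|k-1}\in\mathbb R^n$ be the predicted state estimate, and let the predicted error covariance $P_{k|k-1}\in\mathbb R^{n\times n}$ have given SVD factors $Q_{P_{k|k-1}}$ (orthogonal) and $D^{1/2}_{P_{k|k-1}}$ (diagonal). Generate the cubature nodes ${\mathcal X}_{i,k|k-1}$ with the square-root factor $S_{P_{k|k-1}}:=Q_{P_{k|k-1}}D^{1/2}_{P_{k|k-1}}$, propagate them through $h(k,\cdot)$, and form the centered matrices ${\mathbb X}_{k|k-1}\in\mathbb R^{n\times 2n}$ and ${\mathbb Z}_{k|k-1}\in\mathbb R^{m\times 2n}$, the residual covariance $R_{e,k}={\mathbb Z}_{k|k-1}{\mathbb Z}_{k|k-1}^{\top}+R_k$, the cross-covariance $P_{xz,k}={\mathbb X}_{k|k-1}{\mathbb Z}_{k|k-1}^{\top}$, the cubature gain ${\mathbb K}_k=P_{xz,k}R_{e,k}^{-1}$ and the filtered error covariance $P_{k|k}=P_{k|k-1}-{\mathbb K}_kR_{e,k}{\mathbb K}_k^{\top}$, all as defined in the context. Then the following hold. (1) Define $B=\left[{\mathbb Z}_{k|k-1},\;\;Q_{R_k}D_{R_k}^{1/2}\right]\in\mathbb R^{m\times(2n+m)}$ and let $B=W_B\,[S_B\quad 0]\,V_B^{\top}$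 be a singular value decomposition. Then $$Q_{R_{e,k}}=W_B,\qquad D^{1/2}_{R_{e,k}}=S_B$$ are SVD factors of the residual covariance $R_{e,k}$. (2) With these factors, the cubature gain can be calculated as $${\mathbb K}_k=P_{xz,k}Q_{R_{e,k}}D_{R_{e,k}}^{-1}Q_{R_{e,k}}^{\top}.$$ (3) Define $C=\left[{\mathbb X}_{k|k-1}-{\mathbb K}_k{\mathbb Z}_{k|k-1},\;\;{\mathbb K}_kQ_{R_k}D_{R_k}^{1/2}\right]\in\mathbb R^{n\times(2n+m)}$ and let $C=W_C\,[S_C\quad 0]\,V_C^{\top}$ be a singular value decomposition. Then $$Q_{P_{k|k}}=W_C,\qquad D^{1/2}_{P_{k|k}}=S_C$$ are SVD factors of the filtered error covariance matrix $P_{k|k}$.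
   Context: SVD factors: for a symmetric positive (semi-)definite matrix $P$, its SVD (spectral) factors are an orthogonal matrix $Q_P$ and a diagonal matrix $D_P^{1/2}$ with nonnegative diagonal entries such that $P=Q_PD_PQ_P^{\top}$, where $D_P=(D_P^{1/2})^2$ is the diagonal matrix of the singular values of $P$. Error covariance matrices are symmetric positive (semi-)definite. Singular value decomposition of a wide matrix: for $A\in\mathbb R^{p\times r}$ with $p\le r$, $A=W\,[S\quad 0]\,V^{\top}$ with $W\in\mathbb R^{p\times p}$ and $V\in\mathbb R^{r\times r}$ orthogonal, $S\in\mathbb R^{p\times p}$ diagonal with nonnegative entries (the singular values of $A$), and $0$ the $p\times(r-p)$ zero block. $[X,\;Y]$ denotes horizontal concatenation. Cubature Kalman filter (CKF) quantities: let $e_j$ be the $j$-th unit coordinate vector of $\mathbb R^n$, and $\xi_j=\sqrt n\,e_j$, $\xi_{n+j}=-\sqrt n\,e_j$ for $j=1,\dots,n$. The cubature nodes are ${\mathcal X}_{i,k|k-1}=S_{P_{k|k-1}}\xi_i+\hat x_{k|k-1}$ for $i=1,\dots,2n$, where $P_{k|k-1}=S_{P_{k|k-1}}S_{P_{k|k-1}}^{\top}$. The propagated vectors are ${\mathcal Z}_{i,k|k-1}=h(k,{\mathcal X}_{i,k|k-1})$. Collect them by columns: ${\mathcal X}_{k|k-1}=[{\mathcal X}_{1,k|k-1},\dots,{\mathcal X}_{2n,k|k-1}]$ and ${\mathcal Z}_{k|k-1}=[{\mathcal Z}_{1,k|k-1},\dots,{\mathcal Z}_{2n,k|k-1}]$.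 Let $\mathbf 1_{2n}$ be the column of $2n$ ones and $\hat z_{k|k-1}=\frac1{2n}{\mathcal Z}_{k|k-1}\mathbf 1_{2n}$. The centered matrices are $${\mathbb X}_{k|k-1}=\frac1{\sqrt{2n}}\bigl({\mathcal X}_{k|k-1}-\mathbf 1_{2n}^{\top}\otimes\hat x_{k|k-1}\bigr),\qquad {\mathbb Z}_{k|k-1}=\frac1{\sqrt{2n}}\bigl({\mathcal Z}_{k|k-1}-\mathbf 1_{2n}^{\top}\otimes\hat z_{k|k-1}\bigr),$$ where $\otimes$ is the Kronecker product. The measurement update is then given by $$R_{e,k}={\mathbb Z}_{k|k-1}{\mathbb Z}_{k|k-1}^{\top}+R_k,\quad P_{xz,k}={\mathbb X}_{k|k-1}{\mathbb Z}_{k|k-1}^{\top},\quad {\mathbb K}_k=P_{xz,k}R_{e,k}^{-1},\quad P_{k|k}=P_{k|k-1}-{\mathbb K}_kR_{e,k}{\mathbb K}_k^{\top}.$$ *)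

theory Defs
  imports Complex_Main "Jordan_Normal_Form.Gauss_Jordan_Elimination"
begin

definition sym_pos_def :: "nat \<Rightarrow> real mat \<Rightarrow> bool" where
  "sym_pos_def n A \<longleftrightarrow> A \<in> carrier_mat n n \<and> A\<^sup>T = A \<and>
     (\<forall>x \<in> carrier_vec n. x \<noteq> 0\<^sub>v n \<longrightarrow> x \<bullet> (A *\<^sub>v x) > 0)"

definition sym_pos_semidef :: "nat \<Rightarrow> real mat \<Rightarrow> bool" where
  "sym_pos_semidef n A \<longleftrightarrow> A \<in> carrier_mat n n \<and> A\<^sup>T = A \<and>
     (\<forall>x \<in> carrier_vec n. x \<bullet> (A *\<^sub>v x) \<ge> 0)"

(* The library predicate orthogonal_mat does not require the columns to have unit length. *)
definition is_orthogonal :: "nat \<Rightarrow> real mat \<Rightarrow> bool" where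
  "is_orthogonal n Q \<longleftrightarrow> Q \<in> carrier_mat n n \<and> Q\<^sup>T * Q = 1\<^sub>m n \<and> Q * Q\<^sup>T = 1\<^sub>m n"

definition is_nonneg_diag :: "nat \<Rightarrow> real mat \<Rightarrow> bool" where
  "is_nonneg_diag n D \<longleftrightarrow> D \<in> carrier_mat n n \<and> diagonal_mat D \<and> (\<forall>i < n. D $$ (i, i) \<ge> 0)"

definition append_cols :: "'a :: zero mat \<Rightarrow> 'a mat \<Rightarrow> 'a mat" (infixr \<open>@\<^sub>c\<close> 65) where
  "A @\<^sub>c B = four_block_mat A B (0\<^sub>m 0 (dim_col A)) (0\<^sub>m 0 (dim_col B))"

(* Equals A^{-1} for invertible A; unspecified if A is singular. *)
definition mat_inv :: "'a :: field mat \<Rightarrow> 'a mat" where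
  "mat_inv A = the (mat_inverse A)"

definition kronecker :: "'a :: semiring_1 mat \<Rightarrow> 'a mat \<Rightarrow> 'a mat" where
  "kronecker A B = mat (dim_row A * dim_row B) (dim_col A * dim_col B)
     (\<lambda>(i, j). A $$ (i div dim_row B, j div dim_col B) * B $$ (i mod dim_row B, j mod dim_col B))"

(* The argument Dh stands for D^{1/2}, so that D = Dh * Dh. *)
definition svd_factors :: "nat \<Rightarrow> real mat \<Rightarrow> real mat \<Rightarrow> real mat \<Rightarrow> bool" where
  "svd_factors n P Q Dh \<longleftrightarrow>
     sym_pos_semidef n P \<and> is_orthogonal n Q \<and> is_nonneg_diag n Dh \<and>
     P = Q * (Dh * Dh) * Q\<^sup>T"

(* No ordering of the diagonal entries of S is required. *)
definition wide_svd :: "nat \<Rightarrow> nat \<Rightarrow> real mat \<Rightarrow> real mat \<Rightarrow> real mat \<Rightarrow> real mat \<Rightarrow> bool" where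
  "wide_svd p r A W S V \<longleftrightarrow>
     p \<le> r \<and> A \<in> carrier_mat p r \<and> is_orthogonal p W \<and> is_nonneg_diag p S \<and>
     is_orthogonal r V \<and> A = W * (S @\<^sub>c 0\<^sub>m p (r - p)) * V\<^sup>T"

(* Indices are shifted to start at 0: i < n gives sqrt n e_i, and n <= i < 2 n gives
   - sqrt n e_{i-n}. *)
definition cubature_point :: "nat \<Rightarrow> nat \<Rightarrow> real vec" where
  "cubature_point n i =
     (if i < n then sqrt (real n) \<cdot>\<^sub>v unit_vec n i else (- sqrt (real n)) \<cdot>\<^sub>v unit_vec n (i - n))"

definition cubature_node :: "nat \<Rightarrow> real mat \<Rightarrow> real vec \<Rightarrow> nat \<Rightarrow> real vec" where
  "cubature_node n S xhat i = S *\<^sub>v cubature_point n i + xhat"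

definition ones_vec :: "nat \<Rightarrow> real vec" where
  "ones_vec N = vec N (\<lambda>_. 1)"

definition column_mean :: "nat \<Rightarrow> real mat \<Rightarrow> real vec" where
  "column_mean N Z = (1 / real N) \<cdot>\<^sub>v (Z *\<^sub>v ones_vec N)"

definition centered :: "nat \<Rightarrow> real mat \<Rightarrow> real vec \<Rightarrow> real mat" where
  "centered N A a = (1 / sqrt (real N)) \<cdot>\<^sub>m
     (A - kronecker (mat_of_rows N [ones_vec N]) (mat_of_cols (dim_vec a) [a]))"

end

theory Submission
  imports Defs "Jordan_Normal_Form.Determinant"
begin

text \<open>If $A = W\,[S\;\;0]\,V^{\top}$ then $A A^{\top} = W S^2 W^{\top}$, so an SVD of $A$ yields
  SVD factors of the Gram matrix $A A^{\top}$. It remains to identify $B B^{\top} = R_e$ and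
  $C C^{\top} = P_{k|k}$. The latter uses $K R_e = P_{xz}$ (Joseph form), and that
  $X = \frac{1}{\sqrt 2}\,[S_P,\; -S_P]$, which gives $X X^{\top} = P$.\<close>

section \<open>Gram matrices of block rows and of singular value decompositions\<close>

lemma append_cols_carrier:
  "A \<in> carrier_mat p a \<Longrightarrow> B \<in> carrier_mat p b \<Longrightarrow> A @\<^sub>c B \<in> carrier_mat p (a + b)"
  unfolding append_cols_def by (metis add_0_right carrier_matD(2) four_block_carrier_mat zero_carrier_mat)

text \<open>In four-block form the lower blocks of the concatenation have no rows, so in the product
  with the transpose only the upper left block survives. It is the sum of the two Gram
  matrices.\<close>

lemma append_cols_gram:
  fixes A B :: "'a :: comm_semiring_1 mat"
  assumes A: "A \<in> carrier_mat p a" and B: "B \<in> carrier_mat p b"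
  shows "(A @\<^sub>c B) * (A @\<^sub>c B)\<^sup>T = A * A\<^sup>T + B * B\<^sup>T"
proof -
  have tr: "(A @\<^sub>c B)\<^sup>T = four_block_mat A\<^sup>T (0\<^sub>m a 0) B\<^sup>T (0\<^sub>m b 0)"
    unfolding append_cols_def using A B
    by (subst transpose_four_block_mat[of _ p a _ b _ 0]) auto
  show ?thesis
    unfolding tr unfolding append_cols_def using A B
    by (subst mult_four_block_mat[of _ p a _ b _ 0 _ _ p _ 0]) (auto intro!: eq_matI)
qed

text \<open>The quadratic form at \<open>x\<close> is the squared norm of A^T x. This supplies the
  semidefiniteness required by \<open>svd_factors\<close> and that of Z Z^T inside the residual
  covariance.\<close>

lemma gram_sym_pos_semidef:
  fixes A :: "real mat"
  assumes A: "A \<in> carrier_mat p r"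
  shows "sym_pos_semidef p (A * A\<^sup>T)"
  unfolding sym_pos_semidef_def
proof (intro conjI ballI)
  show "A * A\<^sup>T \<in> carrier_mat p p" using A by simp
  show "(A * A\<^sup>T)\<^sup>T = A * A\<^sup>T" using A by (simp add: transpose_mult)
  fix x :: "real vec" assume x: "x \<in> carrier_vec p"
  have "x \<bullet> ((A * A\<^sup>T) *\<^sub>v x) = x \<bullet> (A *\<^sub>v (A\<^sup>T *\<^sub>v x))"
    using A x by (simp add: assoc_mult_mat_vec[of _ p r _ p])
  also have "\<dots> = (A\<^sup>T *\<^sub>v x) \<bullet> (A\<^sup>T *\<^sub>v x)"
    using A x by (simp add: transpose_vec_mult_scalar[OF A])
  also have "\<dots> \<ge> 0" unfolding scalar_prod_def by (intro sum_nonneg) simp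
  finally show "x \<bullet> ((A * A\<^sup>T) *\<^sub>v x) \<ge> 0" .
qed

lemma nonneg_diag_transpose:
  assumes "is_nonneg_diag p S"
  shows "S\<^sup>T = S"
proof (intro eq_matI)
  fix i j assume "i < dim_row S" "j < dim_col S"
  then show "S\<^sup>T $$ (i, j) = S $$ (i, j)"
    using assms unfolding is_nonneg_diag_def diagonal_mat_def by (cases "i = j") auto
qed (use assms in \<open>auto simp: is_nonneg_diag_def\<close>)

text \<open>In A A^T the factor \<open>V\<close> cancels because V^T V = 1, and [S 0] [S 0]^T = S
  S^T = S S because the zero block contributes nothing and a diagonal matrix is symmetric.\<close>

lemma wide_svd_gram:
  assumes svd: "wide_svd p r A W S V"
  shows "svd_factors p (A * A\<^sup>T) W S"
proof -
  let ?M = "S @\<^sub>c 0\<^sub>m p (r - p)"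
  from svd have pr: "p \<le> r" and A: "A \<in> carrier_mat p r" and W: "W \<in> carrier_mat p p"
    and S: "S \<in> carrier_mat p p" and diag: "is_nonneg_diag p S"
    and V: "V \<in> carrier_mat r r" and VV: "V\<^sup>T * V = 1\<^sub>m r"
    and eq: "A = W * ?M * V\<^sup>T"
    unfolding wide_svd_def is_orthogonal_def is_nonneg_diag_def by auto
  have M: "?M \<in> carrier_mat p r"
    using append_cols_carrier[OF S zero_carrier_mat, of "r - p"] pr by simp
  have MM: "?M * ?M\<^sup>T = S * S"
    using S nonneg_diag_transpose[OF diag]
    by (simp add: append_cols_gram[OF S zero_carrier_mat])
  have WM: "W * ?M \<in> carrier_mat p r" using W M by simp
  have "A * A\<^sup>T = (W * ?M) * V\<^sup>T * (V * (W * ?M)\<^sup>T)"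
    unfolding eq using WM V by (simp add: transpose_mult[OF WM])
  also have "\<dots> = (W * ?M) * ((V\<^sup>T * V) * (W * ?M)\<^sup>T)"
    using WM V by (simp add: assoc_mult_mat[of _ p r _ r _ p] assoc_mult_mat[of _ r r _ r _ p])
  also have "\<dots> = (W * ?M) * (?M\<^sup>T * W\<^sup>T)"
    unfolding VV using W M by (simp add: transpose_mult[OF W M])
  also have "\<dots> = W * (?M * ?M\<^sup>T) * W\<^sup>T"
    using W M by (simp add: assoc_mult_mat[of _ p p _ r _ p] assoc_mult_mat[of _ p r _ p _ p]
        assoc_mult_mat[of _ p p _ p _ p])
  finally have "A * A\<^sup>T = W * (S * S) * W\<^sup>T" unfolding MM .
  then show ?thesis
    unfolding svd_factors_def using gram_sym_pos_semidef[OF A] svd unfolding wide_svd_def by simp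
qed

text \<open>Shows that Q D^{1/2} is a square-root factor. It is applied to the noise covariance and
  to the predicted covariance.\<close>

lemma svd_factors_sqrt_gram:
  assumes "svd_factors n P Q D"
  shows "(Q * D) * (Q * D)\<^sup>T = P"
proof -
  from assms have Q: "Q \<in> carrier_mat n n" and D: "D \<in> carrier_mat n n"
    and tr: "D\<^sup>T = D" and P: "P = Q * (D * D) * Q\<^sup>T"
    unfolding svd_factors_def is_orthogonal_def
    using nonneg_diag_transpose by (auto simp: is_nonneg_diag_def)
  show ?thesis
    unfolding P transpose_mult[OF Q D] tr using Q D by (simp add: assoc_mult_mat[of _ n n _ n _ n])
qed

section \<open>Inverses of positive definite matrices and of matrices given by SVD factors\<close>

lemma invertible_mat_det:
  fixes A :: "'a :: field mat"
  assumes A: "A \<in> carrier_mat n n"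
  shows "invertible_mat A \<longleftrightarrow> det A \<noteq> 0"
proof
  assume "invertible_mat A"
  then obtain B where AB: "A * B = 1\<^sub>m n" and BA: "B * A = 1\<^sub>m (dim_row B)"
    using A unfolding invertible_mat_def inverts_mat_def by auto
  \<comment> \<open>The definition of \<open>invertible_mat\<close> leaves the dimensions of
    \<open>B\<close> open; comparing the column counts in the two identities fixes them.\<close>
  have B: "B \<in> carrier_mat n n"
    using arg_cong[OF AB, of dim_col] arg_cong[OF BA, of dim_col] A by auto
  show "det A \<noteq> 0" using det_mult[OF A B] unfolding AB by auto
next
  assume "det A \<noteq> 0"
  then obtain B where B: "B \<in> carrier_mat n n" "B * A = 1\<^sub>m n" "A * B = 1\<^sub>m n"
    \<comment> \<open>The value \<open>undefined\<close> merely fills the extension slot of the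
      record \<open>ring_mat\<close>; the units do not depend on it.\<close>
    using det_non_zero_imp_unit[OF A, of undefined] unfolding Units_def by (auto simp: ring_mat_def)
  then show "invertible_mat A"
    using A unfolding invertible_mat_def inverts_mat_def by (auto intro!: exI[of _ B])
qed

text \<open>A nonzero determinant makes \<open>A\<close> a unit of the matrix ring, and
  \<open>mat_inverse\<close> returns \<open>None\<close> only for non-units, so the
  \<open>the\<close> in \<open>mat_inv\<close> picks a genuine inverse.\<close>

lemma mat_inv:
  fixes A :: "'a :: field mat"
  assumes A: "A \<in> carrier_mat n n" and inv: "invertible_mat A"
  shows "mat_inv A \<in> carrier_mat n n" "A * mat_inv A = 1\<^sub>m n" "mat_inv A * A = 1\<^sub>m n"
proof -
  have "det A \<noteq> 0" using inv invertible_mat_det[OF A] by simp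
  then have "A \<in> Units (ring_mat TYPE('a) n undefined)" by (rule det_non_zero_imp_unit[OF A])
  then obtain B where "mat_inverse A = Some B" using mat_inverse(1)[OF A] by fastforce
  then show "mat_inv A \<in> carrier_mat n n" "A * mat_inv A = 1\<^sub>m n" "mat_inv A * A = 1\<^sub>m n"
    using mat_inverse(2)[OF A] unfolding mat_inv_def by auto
qed

text \<open>For square matrices a right inverse suffices: det A * det B = 1 makes \<open>A\<close>
  invertible, and associativity then identifies \<open>B\<close> with its inverse.\<close>

lemma mat_inv_eqI:
  fixes A :: "'a :: field mat"
  assumes A: "A \<in> carrier_mat n n" and B: "B \<in> carrier_mat n n" and AB: "A * B = 1\<^sub>m n"
  shows "mat_inv A = B"
proof -
  have "det A \<noteq> 0" using det_mult[OF A B] unfolding AB by auto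
  then have inv: "invertible_mat A" using invertible_mat_det[OF A] by simp
  note I = mat_inv[OF A inv]
  have "mat_inv A = mat_inv A * (A * B)" using I(1) AB by simp
  also have "\<dots> = (mat_inv A * A) * B" using I(1) A B by (simp add: assoc_mult_mat[of _ n n _ n _ n])
  finally show ?thesis using I(3) B by simp
qed

text \<open>A kernel vector makes the quadratic form vanish, so definiteness leaves only the zero
  vector, and a trivial kernel means a nonzero determinant.\<close>

lemma pos_def_invertible:
  assumes "sym_pos_def n A"
  shows "invertible_mat A"
proof -
  have A: "A \<in> carrier_mat n n" using assms unfolding sym_pos_def_def by simp
  have "x = 0\<^sub>v n" if "x \<in> carrier_vec n" "A *\<^sub>v x = 0\<^sub>v n" for x
    using assms that unfolding sym_pos_def_def by fastforce
  then show ?thesis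
    unfolding invertible_mat_det[OF A] det_0_iff_vec_prod_zero_field[OF A] by blast
qed

lemma pos_semidef_add_pos_def:
  assumes A: "sym_pos_semidef n A" and B: "sym_pos_def n B"
  shows "sym_pos_def n (A + B)"
proof -
  have cA: "A \<in> carrier_mat n n" and cB: "B \<in> carrier_mat n n"
    using A B unfolding sym_pos_semidef_def sym_pos_def_def by auto
  have "x \<bullet> ((A + B) *\<^sub>v x) > 0" if x: "x \<in> carrier_vec n" "x \<noteq> 0\<^sub>v n" for x
  proof -
    have "x \<bullet> ((A + B) *\<^sub>v x) = x \<bullet> (A *\<^sub>v x) + x \<bullet> (B *\<^sub>v x)"
      using cA cB x
      by (simp add: add_mult_distrib_mat_vec[OF cA cB] scalar_prod_add_distrib[of _ n])
    moreover have "x \<bullet> (A *\<^sub>v x) \<ge> 0" "x \<bullet> (B *\<^sub>v x) > 0"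
      using A B x unfolding sym_pos_semidef_def sym_pos_def_def by auto
    ultimately show ?thesis by simp
  qed
  then show ?thesis
    using A B cA cB unfolding sym_pos_def_def sym_pos_semidef_def
    by (auto simp: transpose_add[OF cA cB])
qed

text \<open>Determinants in P = W S^2 W^T show that S^2 is invertible, so its \<open>mat_inv\<close>
  is a true inverse. Orthogonality of \<open>W\<close> then makes W (S^2)^{-1} W^T a right inverse
  of \<open>P\<close>. This yields the gain formula.\<close>

lemma svd_factors_mat_inv:
  assumes svd: "svd_factors n P W S" and inv: "invertible_mat P"
  shows "invertible_mat (S * S)" "mat_inv P = W * mat_inv (S * S) * W\<^sup>T"
proof -
  from svd have P: "P \<in> carrier_mat n n" and W: "W \<in> carrier_mat n n" and S: "S \<in> carrier_mat n n"
    and WW: "W\<^sup>T * W = 1\<^sub>m n" "W * W\<^sup>T = 1\<^sub>m n" and eq: "P = W * (S * S) * W\<^sup>T"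
    unfolding svd_factors_def sym_pos_semidef_def is_orthogonal_def is_nonneg_diag_def by auto
  have SS: "S * S \<in> carrier_mat n n" using S by simp
  have "det P = det W * det (S * S) * det (W\<^sup>T)"
    unfolding eq using W SS by (simp add: det_mult[of _ n])
  then have "det (S * S) \<noteq> 0" using inv invertible_mat_det[OF P] by auto
  then show invS: "invertible_mat (S * S)" using invertible_mat_det[OF SS] by simp
  define J where "J = mat_inv (S * S)"
  note I = mat_inv[OF SS invS, folded J_def]
  have "P * (W * J * W\<^sup>T) = W * (S * S) * ((W\<^sup>T * W) * (J * W\<^sup>T))"
    unfolding eq using W SS I(1) by (simp add: assoc_mult_mat[of _ n n _ n _ n])
  also have "\<dots> = W * ((S * S) * J) * W\<^sup>T"
    unfolding WW using W SS I(1) by (simp add: assoc_mult_mat[of _ n n _ n _ n])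
  also have "\<dots> = 1\<^sub>m n" unfolding I(2) using W WW by simp
  finally show "mat_inv P = W * mat_inv (S * S) * W\<^sup>T"
    unfolding J_def[symmetric] using W I(1) by (intro mat_inv_eqI[OF P]) auto
qed

section \<open>Centered cubature nodes and their Gram matrix\<close>

lemma centered_carrier:
  "A \<in> carrier_mat p N \<Longrightarrow> a \<in> carrier_vec p \<Longrightarrow> centered N A a \<in> carrier_mat p N"
  unfolding centered_def kronecker_def by (auto simp: ones_vec_def)

text \<open>The Kronecker product of the row of ones with the column \<open>a\<close> repeats
  \<open>a\<close> in every column.\<close>

lemma centered_index:
  assumes "A \<in> carrier_mat p N" "a \<in> carrier_vec p" "i < p" "j < N"
  shows "centered N A a $$ (i, j) = (A $$ (i, j) - a $ i) / sqrt (real N)"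
  using assms unfolding centered_def kronecker_def
  by (auto simp: ones_vec_def mat_of_rows_index mat_of_cols_index)

text \<open>Each node is the predicted state plus or minus sqrt n times a column of
  \<open>S\<close>. Centering removes the state, and the scale becomes sqrt n / sqrt (2 n) = 1 /
  sqrt 2.\<close>

lemma centered_cubature_nodes:
  assumes S: "S \<in> carrier_mat n n" and xhat: "xhat \<in> carrier_vec n"
  shows "centered (2 * n) (mat_of_cols n (map (cubature_node n S xhat) [0 ..< 2 * n])) xhat
    = ((1 / sqrt 2) \<cdot>\<^sub>m S) @\<^sub>c ((- 1 / sqrt 2) \<cdot>\<^sub>m S)" (is "centered _ ?XX _ = ?R")
proof (intro eq_matI)
  have XX: "?XX \<in> carrier_mat n (2 * n)" by (intro carrier_matI) simp_all
  have R: "?R \<in> carrier_mat n (2 * n)" unfolding mult_2 using S by (intro append_cols_carrier) auto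
  show "dim_row (centered (2 * n) ?XX xhat) = dim_row ?R" "dim_col (centered (2 * n) ?XX xhat) = dim_col ?R"
    using centered_carrier[OF XX xhat] R by auto
  fix i j assume "i < dim_row ?R" "j < dim_col ?R"
  then have i: "i < n" and j: "j < 2 * n" using R by auto
  \<comment> \<open>The existence of a row index \<open>i\<close> forces n > 0, which permits
    cancelling sqrt n below.\<close>
  have s: "sqrt (real n) \<noteq> 0" using i by simp
  show "centered (2 * n) ?XX xhat $$ (i, j) = ?R $$ (i, j)"
  proof (cases "j < n")
    case True
    have "?XX $$ (i, j) = sqrt (real n) * S $$ (i, j) + xhat $ i"
      using True i j S xhat
      by (simp add: mat_of_cols_index cubature_node_def cubature_point_def
          mult_mat_vec[OF S])
    then show ?thesis
      unfolding centered_index[OF XX xhat i j] using True i S s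
      by (simp add: append_cols_def real_sqrt_mult)
  next
    case False
    then have "?XX $$ (i, j) = - sqrt (real n) * S $$ (i, j - n) + xhat $ i"
      using i j S xhat
      by (simp add: mat_of_cols_index cubature_node_def cubature_point_def
          mult_mat_vec[OF S])
    then show ?thesis
      unfolding centered_index[OF XX xhat i j] using False i j S s
      by (simp add: append_cols_def real_sqrt_mult)
  qed
qed

text \<open>Each of the two blocks contributes one half of S S^T, the sign disappearing in the
  square. Thus the cubature nodes reproduce the predicted covariance exactly.\<close>

lemma centered_cubature_nodes_gram:
  assumes S: "S \<in> carrier_mat n n" and xhat: "xhat \<in> carrier_vec n"
    and X: "X = centered (2 * n) (mat_of_cols n (map (cubature_node n S xhat) [0 ..< 2 * n])) xhat"
  shows "X * X\<^sup>T = S * S\<^sup>T"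
proof -
  have smult_gram: "(c \<cdot>\<^sub>m S) * (c \<cdot>\<^sub>m S)\<^sup>T = (c * c) \<cdot>\<^sub>m (S * S\<^sup>T)" for c
  proof -
    have "(c \<cdot>\<^sub>m S)\<^sup>T = c \<cdot>\<^sub>m S\<^sup>T" by (intro eq_matI) auto
    then show ?thesis
      using S by (intro eq_matI) (auto simp: mult_smult_distrib[of _ n n _ n] mult_smult_assoc_mat[of _ n n _ n])
  qed
  show ?thesis
    unfolding X centered_cubature_nodes[OF S xhat]
    using S by (subst append_cols_gram[of _ n n _ n]) (auto simp: smult_gram intro!: eq_matI)
qed

section \<open>Joseph form of the filtered covariance\<close>

text \<open>Expanding gives P - E - E^T + K (Z Z^T + R) K^T with cross term E = X Z^T K^T. The gain
  equation turns the last summand into \<open>E\<close> and makes \<open>E\<close> symmetric, so P -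
  E remains. The matrix \<open>L\<close> is a square-root factor of \<open>R\<close>.\<close>

lemma joseph_form:
  fixes X Z K R P L :: "'a :: comm_ring_1 mat"
  assumes X: "X \<in> carrier_mat n r" and Z: "Z \<in> carrier_mat m r" and K: "K \<in> carrier_mat n m"
    and L: "L \<in> carrier_mat m m"
    and P: "X * X\<^sup>T = P" and R: "L * L\<^sup>T = R"
    and gain: "K * (Z * Z\<^sup>T + R) = X * Z\<^sup>T"
  shows "((X - K * Z) @\<^sub>c (K * L)) * ((X - K * Z) @\<^sub>c (K * L))\<^sup>T
    = P - K * (Z * Z\<^sup>T + R) * K\<^sup>T"
proof -
  have KZ: "K * Z \<in> carrier_mat n r" and KL: "K * L \<in> carrier_mat n m"
    using K Z L by auto
  have Rc: "R \<in> carrier_mat m m" using L unfolding R[symmetric] by simp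
  have ZX: "X * Z\<^sup>T \<in> carrier_mat n m" "Z * X\<^sup>T \<in> carrier_mat m n" "Z * Z\<^sup>T \<in> carrier_mat m m"
    using X Z by auto
  define E where "E = X * Z\<^sup>T * K\<^sup>T"
  have Ec: "E \<in> carrier_mat n n" using ZX K unfolding E_def by simp
  have split: "E = K * (Z * Z\<^sup>T) * K\<^sup>T + K * R * K\<^sup>T"
    unfolding E_def gain[symmetric] using K ZX Rc
    by (simp add: mult_add_distrib_mat[of _ n m _ m] add_mult_distrib_mat[of _ n m _ _ n])
  have c: "K * (Z * Z\<^sup>T) * K\<^sup>T \<in> carrier_mat n n" "K * R * K\<^sup>T \<in> carrier_mat n n"
    using K ZX Rc by auto
  \<comment> \<open>By \<open>split\<close>, \<open>E\<close> is a sum of terms K M K^T with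
    \<open>M\<close> symmetric. Hence the second cross term K Z X^T, which is the transpose of
    \<open>E\<close>, equals \<open>E\<close>.\<close>
  have "E\<^sup>T = E"
  proof -
    have "R\<^sup>T = R" unfolding R[symmetric] using L by (simp add: transpose_mult[of _ m m])
    moreover have "(Z * Z\<^sup>T)\<^sup>T = Z * Z\<^sup>T" using Z by (simp add: transpose_mult[of _ m r])
    ultimately have "(K * M * K\<^sup>T)\<^sup>T = K * M * K\<^sup>T" if "M = R \<or> M = Z * Z\<^sup>T" for M
      using that K ZX Rc by (auto simp: transpose_mult[of _ n m _ n] transpose_mult[of _ m m _ n]
        assoc_mult_mat[of _ n m _ m _ n])
    then show ?thesis unfolding split transpose_add[OF c] by presburger
  qed
  moreover have "E\<^sup>T = K * (Z * X\<^sup>T)"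
  proof -
    have "E\<^sup>T = K * (X * Z\<^sup>T)\<^sup>T"
      unfolding E_def using ZX K by (subst transpose_mult[of _ n m _ n]) auto
    also have "(X * Z\<^sup>T)\<^sup>T = Z * X\<^sup>T"
      using X Z by (subst transpose_mult[of _ n r _ m]) auto
    finally show ?thesis .
  qed
  ultimately have KZX: "K * (Z * X\<^sup>T) = E" by simp
  have XKZ: "X * (K * Z)\<^sup>T = E"
    unfolding E_def transpose_mult[OF K Z] using X Z K by (simp add: assoc_mult_mat[of _ n r _ m _ n])
  have "(X - K * Z) * (X - K * Z)\<^sup>T = (X * X\<^sup>T - K * Z * X\<^sup>T) - (X * (K * Z)\<^sup>T - K * Z * (K * Z)\<^sup>T)"
  proof -
    have t: "X\<^sup>T \<in> carrier_mat r n" "(K * Z)\<^sup>T \<in> carrier_mat r n" using X KZ by auto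
    show ?thesis
      unfolding transpose_minus[OF X KZ] mult_minus_distrib_mat[OF minus_carrier_mat[OF KZ] t]
        minus_mult_distrib_mat[OF X KZ t(1)] minus_mult_distrib_mat[OF X KZ t(2)] ..
  qed
  also have "\<dots> = (P - E) - (E - K * (Z * Z\<^sup>T) * K\<^sup>T)"
    unfolding P XKZ using KZX X Z K
    by (simp add: assoc_mult_mat[of _ n m _ r _ n] assoc_mult_mat[of _ n m _ m _ n]
        transpose_mult[OF K Z] assoc_mult_mat[of _ m r _ m _ n])
  finally have XX: "(X - K * Z) * (X - K * Z)\<^sup>T = (P - E) - (E - K * (Z * Z\<^sup>T) * K\<^sup>T)" .
  have LL: "(K * L) * (K * L)\<^sup>T = K * R * K\<^sup>T"
    unfolding R[symmetric] transpose_mult[OF K L] using K L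
    by (simp add: assoc_mult_mat[of _ n m _ m _ n] assoc_mult_mat[of _ n m _ m _ m]
        assoc_mult_mat[of _ m m _ m _ n])
  have Pc: "P \<in> carrier_mat n n" using X unfolding P[symmetric] by simp
  have "((X - K * Z) @\<^sub>c (K * L)) * ((X - K * Z) @\<^sub>c (K * L))\<^sup>T
    = (P - E) - (E - K * (Z * Z\<^sup>T) * K\<^sup>T) + K * R * K\<^sup>T"
    unfolding XX[symmetric] LL[symmetric] by (rule append_cols_gram[OF minus_carrier_mat[OF KZ] KL])
  \<comment> \<open>Regrouping collects the two quadratic terms into the sum that
    \<open>split\<close> equates with \<open>E\<close>, so the inner difference vanishes.\<close>
  also have "\<dots> = (P - E) - (E - (K * (Z * Z\<^sup>T) * K\<^sup>T + K * R * K\<^sup>T))"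
    using Pc Ec c by (intro eq_matI) auto
  also have "\<dots> = P - E" unfolding split[symmetric] using Pc Ec by (intro eq_matI) auto
  finally show ?thesis unfolding gain E_def .
qed

section \<open>SVD factors for the measurement update\<close>

theorem lemma2:
  fixes n m k :: nat
    and h :: "nat \<Rightarrow> real vec \<Rightarrow> real vec"
    and R Q_R Dh_R P Q_P Dh_P S_P XX ZZ X Z R_e P_xz K P_filt B C :: "real mat"
    and xhat zhat :: "real vec"
  assumes n: "n \<ge> 1" and m: "m \<ge> 1"
    and h: "\<And>x. x \<in> carrier_vec n \<Longrightarrow> h k x \<in> carrier_vec m"
    and R_pos: "sym_pos_def m R"
    and R_svd: "svd_factors m R Q_R Dh_R"
    and xhat: "xhat \<in> carrier_vec n"
    and P_svd: "svd_factors n P Q_P Dh_P"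
    and S_P: "S_P = Q_P * Dh_P"
    and XX: "XX = mat_of_cols n (map (\<lambda>i. cubature_node n S_P xhat i) [0 ..< 2 * n])"
    and ZZ: "ZZ = mat_of_cols m (map (\<lambda>i. h k (cubature_node n S_P xhat i)) [0 ..< 2 * n])"
    and zhat: "zhat = column_mean (2 * n) ZZ"
    and X: "X = centered (2 * n) XX xhat"
    and Z: "Z = centered (2 * n) ZZ zhat"
    and R_e: "R_e = Z * Z\<^sup>T + R"
    and P_xz: "P_xz = X * Z\<^sup>T"
    and K: "K = P_xz * mat_inv R_e"
    and P_filt: "P_filt = P - K * R_e * K\<^sup>T"
    and B: "B = Z @\<^sub>c (Q_R * Dh_R)"
    and C: "C = (X - K * Z) @\<^sub>c (K * Q_R * Dh_R)"
  shows "invertible_mat R_e \<and>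
         (\<forall>W S V. wide_svd m (2 * n + m) B W S V \<longrightarrow>
            svd_factors m R_e W S \<and>
            invertible_mat (S * S) \<and>
            K = P_xz * W * mat_inv (S * S) * W\<^sup>T) \<and>
         (\<forall>W S V. wide_svd n (2 * n + m) C W S V \<longrightarrow>
            svd_factors n P_filt W S)"
proof -
  define L where "L = Q_R * Dh_R"
  from R_svd have Q: "Q_R \<in> carrier_mat m m" and D: "Dh_R \<in> carrier_mat m m"
    unfolding svd_factors_def is_orthogonal_def is_nonneg_diag_def by auto
  then have L: "L \<in> carrier_mat m m" unfolding L_def by simp
  have LL: "L * L\<^sup>T = R" unfolding L_def by (rule svd_factors_sqrt_gram[OF R_svd])
  have S: "S_P \<in> carrier_mat n n"
    using P_svd unfolding S_P svd_factors_def is_orthogonal_def is_nonneg_diag_def by auto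
  have XXT: "X * X\<^sup>T = P"
    using centered_cubature_nodes_gram[OF S xhat X[unfolded XX]]
      svd_factors_sqrt_gram[OF P_svd] unfolding S_P by simp
  have Xc: "X \<in> carrier_mat n (2 * n)"
    unfolding X XX by (intro centered_carrier xhat carrier_matI) simp_all
  have ZZc: "ZZ \<in> carrier_mat m (2 * n)" unfolding ZZ by (intro carrier_matI) simp_all
  have Zc: "Z \<in> carrier_mat m (2 * n)"
    unfolding Z zhat column_mean_def using ZZc
    by (intro centered_carrier smult_carrier_vec mult_mat_vec_carrier) (auto simp: ones_vec_def)
  \<comment> \<open>The noise covariance adds strict definiteness to the semidefinite Z Z^T; this is
    what makes the gain well defined.\<close>
  have pd: "sym_pos_def m R_e"
    unfolding R_e by (rule pos_semidef_add_pos_def[OF gram_sym_pos_semidef[OF Zc] R_pos])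
  then have Rec: "R_e \<in> carrier_mat m m" unfolding sym_pos_def_def by simp
  have inv: "invertible_mat R_e" by (rule pos_def_invertible[OF pd])
  note I = mat_inv[OF Rec inv]
  have Pxz: "P_xz \<in> carrier_mat n m" unfolding P_xz using Xc Zc by simp
  have Kc: "K \<in> carrier_mat n m" unfolding K using Pxz I(1) by simp
  \<comment> \<open>The defining equation of the gain with the inverse cleared is the form required
    by the Joseph identity.\<close>
  have gain: "K * R_e = P_xz"
    unfolding K using Pxz I Rec by (simp add: assoc_mult_mat[of _ n m _ m _ m])
  have BB: "B * B\<^sup>T = R_e"
    unfolding B R_e L_def[symmetric] append_cols_gram[OF Zc L] LL ..
  \<comment> \<open>Reassociation matches the right block of \<open>C\<close> with the block
    \<open>K * L\<close> of the Joseph form.\<close>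
  have "K * Q_R * Dh_R = K * L"
    unfolding L_def using Kc Q D by (simp add: assoc_mult_mat[of _ n m _ m _ m])
  then have CC: "C * C\<^sup>T = P_filt"
    unfolding C P_filt R_e
    using joseph_form[OF Xc Zc Kc L XXT LL gain[unfolded R_e P_xz]] by simp
  have "svd_factors m R_e W S \<and> invertible_mat (S * S) \<and> K = P_xz * W * mat_inv (S * S) * W\<^sup>T"
    if svd: "wide_svd m (2 * n + m) B W S V" for W S V
  proof -
    have f: "svd_factors m R_e W S" using wide_svd_gram[OF svd] unfolding BB .
    note J = svd_factors_mat_inv[OF f inv]
    have W: "W \<in> carrier_mat m m" and SS: "S * S \<in> carrier_mat m m"
      using svd unfolding wide_svd_def is_orthogonal_def is_nonneg_diag_def by auto
    have "K = P_xz * W * mat_inv (S * S) * W\<^sup>T"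
      \<comment> \<open>Substituting the factored inverse of \<open>R_e\<close> into the gain leaves
        only a reassociation.\<close>
      unfolding K J(2) using Pxz W mat_inv(1)[OF SS J(1)]
      by (simp add: assoc_mult_mat[of _ n m _ m _ m] assoc_mult_mat[of _ m m _ m _ m])
    with f J(1) show ?thesis by simp
  qed
  moreover have "svd_factors n P_filt W S" if "wide_svd n (2 * n + m) C W S V" for W S V
    using wide_svd_gram[OF that] unfolding CC .
  ultimately show ?thesis using inv by blast
qed

end
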